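(* There is no nondegenerate simplicial map $f\colon X(\mathbb{F}_2^4)\to X(\mathbb{F}_3^4)$.
   Context: For a prime $p$ and a natural number $n$, the universal simplicial complex $X(\mathbb{F}_p^n)$ is the abstract simplicial complex whose vertices are the nonzero vectors of $\mathbb{F}_p^n$ and whose simplices are the sets of vectors that are linearly independent over $\mathbb{F}_p$. A simplicial map is nondegenerate if it is injective on the vertex set of every simplex (equivalently, it maps every $j$-simplex onto a $j$-simplex). *)

theory Defs
  imports "HOL-Analysis.Cartesian_Space" "Berlekamp_Zassenhaus.Finite_Field"
begin

text \<open>
  The prime field with \<open>p\<close> elements is \<open>'p mod_ring\<close> with \<open>CARD('p) = p\<close>. To use it at the
  numeral types \<open>2 = num1 bit0\<close> and \<open>3 = num1 bit1\<close>, these must be instances of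
  \<^class>\<open>prime_card\<close>; the arities are stated for \<^class>\<open>CARD_1\<close> because an arity cannot mention
  the argument \<open>num1\<close> itself.
\<close>

instance bit0 :: (CARD_1) prime_card
  by standard (simp add: card_bit0 CARD_1)

instance bit1 :: (CARD_1) prime_card
  by standard (simp add: card_bit1 CARD_1)

text \<open>
  A simplicial complex is represented by its set of simplices, and its vertices are the points
  lying in some simplex. The empty set is admitted as a face; it imposes no condition on maps.
\<close>

definition abstract_simplicial_complex :: "'a set set \<Rightarrow> bool" where
  "abstract_simplicial_complex K \<longleftrightarrow>
     (\<forall>\<sigma>\<in>K. finite \<sigma>) \<and> (\<forall>\<sigma>\<in>K. \<forall>\<tau>. \<tau> \<subseteq> \<sigma> \<longrightarrow> \<tau> \<in> K)"

definition vertices :: "'a set set \<Rightarrow> 'a set" where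
  "vertices K = \<Union>K"

text \<open>Only the values of \<open>f\<close> on the vertices of \<open>K\<close> matter in the next two definitions.\<close>

definition simplicial_map :: "'a set set \<Rightarrow> 'b set set \<Rightarrow> ('a \<Rightarrow> 'b) \<Rightarrow> bool" where
  "simplicial_map K L f \<longleftrightarrow> f ` vertices K \<subseteq> vertices L \<and> (\<forall>\<sigma>\<in>K. f ` \<sigma> \<in> L)"

definition nondegenerate_simplicial_map :: "'a set set \<Rightarrow> 'b set set \<Rightarrow> ('a \<Rightarrow> 'b) \<Rightarrow> bool" where
  "nondegenerate_simplicial_map K L f \<longleftrightarrow> simplicial_map K L f \<and> (\<forall>\<sigma>\<in>K. inj_on f \<sigma>)"

definition universal_complex :: "('p::prime_card mod_ring ^ 'n) set set" where
  "universal_complex = {\<sigma>. vec.independent \<sigma>}"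

lemma abstract_simplicial_complex_universal_complex:
  "abstract_simplicial_complex (universal_complex :: ('p::prime_card mod_ring ^ 'n) set set)"
  unfolding abstract_simplicial_complex_def universal_complex_def
  using vec.independent_mono by auto

lemma vertices_universal_complex:
  "vertices (universal_complex :: ('p::prime_card mod_ring ^ 'n) set set) = {v. v \<noteq> 0}"
proof -
  have "\<exists>\<sigma>. vec.independent \<sigma> \<and> v \<in> \<sigma>" if "v \<noteq> 0" for v :: "'p mod_ring ^ 'n"
    using that by (intro exI[of _ "{v}"]) simp
  then show ?thesis
    unfolding vertices_def universal_complex_def using vec.dependent_zero by auto
qed

end

theory Submission
  imports Defs
begin

text \<open>
  Suppose that \<open>f\<close> is such a map. Take a projective frame of \<open>\<F>\<^sub>2\<^sup>4\<close>: five vectors \<open>u\<^sub>i\<close> with sum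
  \<open>0\<close>, any four of which are independent. Their images are again in general position, so multiples
  \<open>p\<^sub>i\<close> of them form a projective frame of \<open>\<F>\<^sub>3\<^sup>4\<close>. The remaining ten nonzero vectors of \<open>\<F>\<^sub>2\<^sup>4\<close> are the
  sums \<open>u\<^sub>i + u\<^sub>j\<close>, that is, the edges of the complete graph on five points. Independence from triples
  of frame vectors leaves, up to a scalar, five possible images for such an edge: \<open>p\<^sub>i + p\<^sub>j\<close> (a sum
  edge), \<open>p\<^sub>i - p\<^sub>j\<close> (a difference edge), or \<open>p\<^sub>i + p\<^sub>j - p\<^sub>x\<close> for one of the three other points \<open>x\<close> (a
  defect edge); this is \<open>edge_cases\<close>.

  Two facts contradict each other. If all four edges at one point \<open>i\<close> are sum edges, then their
  images add up to \<open>3 p\<^sub>i + (\<Sum>j. p\<^sub>j) = 0\<close>, although the four vectors \<open>u\<^sub>i + u\<^sub>j\<close> are independent over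
  \<open>\<F>\<^sub>2\<close>: a determinant equal to \<open>3\<close> is odd but vanishes modulo \<open>3\<close>. This is \<open>no_star_of_sum_edges\<close>.
  On the other hand, two edges that share a point cannot both fail to be sum edges
  (\<open>no_adjacent_nonsum_edges\<close>), so the edges that are not sum edges form a matching. Five is odd, so
  a matching misses a point, and all edges at that point are sum edges.

  Scalars play no part in independence, so images are only tracked up to nonzero multiples. Each
  forbidden configuration is refuted in the same way: four vectors that are independent over \<open>\<F>\<^sub>2\<close>
  are exhibited whose images satisfy a linear relation over \<open>\<F>\<^sub>3\<close>, which holds because
  \<open>3 = 0\<close> and the \<open>p\<^sub>i\<close> add up to \<open>0\<close>.
\<close>

section \<open>The fields with two and three elements\<close>

lemma mod_ring_2_cases: "(a :: 2 mod_ring) = 0 \<or> a = 1"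
proof -
  have "card {0, 1 :: 2 mod_ring} = CARD(2 mod_ring)" by simp
  then have "{0, 1 :: 2 mod_ring} = UNIV" by (intro card_subset_eq) auto
  then show ?thesis by auto
qed

lemma mod_ring_2_two: "(1 + 1 :: 2 mod_ring) = 0"
  using of_nat_card_eq_0[where ?'a = 2] by simp

lemma mod_ring_3_three: "(1 + 1 + 1 :: 3 mod_ring) = 0"
  using of_nat_card_eq_0[where ?'a = 3] by simp

lemma mod_ring_3_cases: "(a :: 3 mod_ring) = 0 \<or> a = 1 \<or> a = - 1"
proof -
  have "(1::3 mod_ring) \<noteq> -1"
    using mod_ring_3_three by (metis add.right_neutral add.right_inverse add.assoc one_neq_zero)
  then have "card {0, 1, -1 :: 3 mod_ring} = CARD(3 mod_ring)" by simp
  then have "{0, 1, -1 :: 3 mod_ring} = UNIV" by (intro card_subset_eq) auto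
  then show ?thesis by auto
qed

lemma mod_ring_3_eq_multiple: "a \<noteq> 0 \<Longrightarrow> (x :: 3 mod_ring) = 0 \<or> x = a \<or> x = - a"
  using mod_ring_3_cases[of a] mod_ring_3_cases[of x] by auto

lemma triple_eq_zero: "x + x + x = (0 :: 3 mod_ring ^ 'n)"
proof -
  have "x + x + x = (1 + 1 + 1) *s x" by (simp only: vector_sadd_rdistrib vec.scale_one)
  then show ?thesis unfolding mod_ring_3_three by simp
qed

section \<open>Independence of four vectors\<close>

text \<open>
  The vectors are listed, not collected in a set, so that independence also says that they are
  distinct. A nondegenerate simplicial map preserves exactly this combination.
\<close>

definition independent4 :: "'a::field ^ 'n \<Rightarrow> 'a ^ 'n \<Rightarrow> 'a ^ 'n \<Rightarrow> 'a ^ 'n \<Rightarrow> bool" where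
  "independent4 x y z w \<longleftrightarrow>
     (\<forall>a b c d. a *s x + b *s y + c *s z + d *s w = 0 \<longrightarrow> a = 0 \<and> b = 0 \<and> c = 0 \<and> d = 0)"

lemma independent4_iff:
  "independent4 x y z w \<longleftrightarrow> distinct [x, y, z, w] \<and> vec.independent {x, y, z, w}"
proof
  assume ind: "independent4 x y z w"
  have "x \<noteq> y" using ind[unfolded independent4_def, rule_format, of 1 "-1" 0 0] by auto
  moreover have "x \<noteq> z" using ind[unfolded independent4_def, rule_format, of 1 0 "-1" 0] by auto
  moreover have "x \<noteq> w" using ind[unfolded independent4_def, rule_format, of 1 0 0 "-1"] by auto
  moreover have "y \<noteq> z" using ind[unfolded independent4_def, rule_format, of 0 1 "-1" 0] by auto
  moreover have "y \<noteq> w" using ind[unfolded independent4_def, rule_format, of 0 1 0 "-1"] by auto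
  moreover have "z \<noteq> w" using ind[unfolded independent4_def, rule_format, of 0 0 1 "-1"] by auto
  ultimately have dist: "distinct [x, y, z, w]" by simp
  then have "(\<Sum>v\<in>{x, y, z, w}. g v *s v) = g x *s x + g y *s y + g z *s z + g w *s w" for g
    by (simp add: add.assoc)
  then show "distinct [x, y, z, w] \<and> vec.independent {x, y, z, w}"
    using ind[unfolded independent4_def] dist
    by (simp only: vec.dependent_finite finite.intros) blast
next
  assume *: "distinct [x, y, z, w] \<and> vec.independent {x, y, z, w}"
  show "independent4 x y z w"
    unfolding independent4_def
  proof (intro allI impI)
    fix a b c d
    assume eq: "a *s x + b *s y + c *s z + d *s w = 0"
    define g where "g v = (if v = x then a else if v = y then b else if v = z then c else d)" for v
    have g: "g x = a" "g y = b" "g z = c" "g w = d" using * by (auto simp: g_def)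
    have "(\<Sum>v\<in>{x, y, z, w}. g v *s v) = 0" using * eq g by (simp add: add.assoc)
    then have "\<forall>v\<in>{x, y, z, w}. g v = 0" using * by (auto simp: vec.dependent_finite)
    then show "a = 0 \<and> b = 0 \<and> c = 0 \<and> d = 0" using g by auto
  qed
qed

text \<open>
  In the relations below the first coefficient is always \<open>1\<close>, so no nonvanishing has to be checked.
\<close>

lemma independent4D: "independent4 x y z w \<Longrightarrow> x + b *s y + c *s z + d *s w \<noteq> 0"
  unfolding independent4_def by (metis vec.scale_one one_neq_zero)

lemma independent4_spans:
  fixes x :: "'a::field ^ 4"
  assumes "independent4 x y z w"
  obtains a b c d where "v = a *s x + b *s y + c *s z + d *s w"
proof -
  have "vec.independent {x, y, z, w}" and card: "card {x, y, z, w} = 4"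
    using assms by (auto simp: independent4_iff)
  then have "vec.span {x, y, z, w} = UNIV"
    using vec.card_eq_dim[of "{x, y, z, w}" UNIV] by (auto simp: vec.dim_UNIV card_cart_basis)
  then have "v \<in> vec.span {x, y, z, w}" by simp
  then obtain a b c d where "v - a *s x - b *s y - c *s z - d *s w = 0"
    by (auto simp: vec.span_insert)
  then have "v = a *s x + b *s y + c *s z + d *s w" by (simp add: algebra_simps)
  then show thesis by (rule that)
qed

definition proportional :: "'a::field ^ 'n \<Rightarrow> 'a ^ 'n \<Rightarrow> bool" where
  "proportional x y \<longleftrightarrow> (\<exists>c. c \<noteq> 0 \<and> x = c *s y)"

lemma independent4_proportional:
  assumes "independent4 x y z w"
    and "proportional x x'" "proportional y y'" "proportional z z'" "proportional w w'"
  shows "independent4 x' y' z' w'"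
proof -
  obtain p q r s where nz: "p \<noteq> 0" "q \<noteq> 0" "r \<noteq> 0" "s \<noteq> 0"
    and eqs: "x = p *s x'" "y = q *s y'" "z = r *s z'" "w = s *s w'"
    using assms(2-5) unfolding proportional_def by blast
  show ?thesis unfolding independent4_def
  proof (intro allI impI)
    fix a b c d assume "a *s x' + b *s y' + c *s z' + d *s w' = 0"
    then have "(a / p) *s x + (b / q) *s y + (c / r) *s z + (d / s) *s w = 0"
      using nz by (simp add: eqs)
    then show "a = 0 \<and> b = 0 \<and> c = 0 \<and> d = 0"
      using assms(1) nz unfolding independent4_def by (metis divide_eq_0_iff)
  qed
qed

section \<open>Combinatorics of five points\<close>

lemma obtain_fresh:
  assumes "CARD('i::finite) = 5" and "length xs < 5"
  obtains x :: "'i::finite" where "x \<notin> set xs"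
proof -
  have "card (set xs) < CARD('i)" using card_length[of xs] assms by linarith
  then have "set xs \<noteq> UNIV" by auto
  then show thesis using that by blast
qed

lemma five_distinct_UNIV:
  assumes "CARD('i::finite) = 5" and "distinct [i, j, k, l, m :: 'i::finite]"
  shows "UNIV = {i, j, k, l, m}"
proof -
  have "card (set [i, j, k, l, m]) = CARD('i)" using distinct_card[OF assms(2)] assms(1) by simp
  then show ?thesis using card_subset_eq[of UNIV "set [i, j, k, l, m]"] by auto
qed

lemma extend_to_five:
  assumes "CARD('i::finite) = 5" and "i \<noteq> (j :: 'i::finite)"
  obtains k l m where "distinct [i, j, k, l, m]"
proof -
  obtain k where k: "k \<notin> set [i, j]" using obtain_fresh[OF assms(1), of "[i, j]"] by auto
  obtain l where l: "l \<notin> set [i, j, k]" using obtain_fresh[OF assms(1), of "[i, j, k]"] by auto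
  obtain m where m: "m \<notin> set [i, j, k, l]" using obtain_fresh[OF assms(1), of "[i, j, k, l]"] by auto
  show thesis using that[of k l m] assms(2) k l m by auto
qed

text \<open>
  Five is odd. Two disjoint edges \<open>ij\<close> and \<open>kl\<close> exhaust all points but one, and an edge at that
  point would meet one of them.
\<close>

lemma unmatched_point_of_five:
  fixes R :: "'i::finite \<Rightarrow> 'i \<Rightarrow> bool"
  assumes card: "CARD('i) = 5"
    and sym: "\<And>i j. R i j \<Longrightarrow> R j i"
    and matching: "\<And>i j k. R i j \<Longrightarrow> R i k \<Longrightarrow> distinct [i, j, k] \<Longrightarrow> False"
  obtains i where "\<And>j. j \<noteq> i \<Longrightarrow> \<not> R i j"
proof -
  have False if ex: "\<And>i. \<exists>j. j \<noteq> i \<and> R i j"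
  proof -
    obtain i j :: 'i where ij: "j \<noteq> i" "R i j" using ex by blast
    obtain k where k: "k \<notin> set [i, j]" using obtain_fresh[OF card, of "[i, j]"] by auto
    obtain l where l: "l \<noteq> k" "R k l" using ex by blast
    have "\<not> R i k" "\<not> R j k"
      using matching[of i j k] matching[of j i k] sym[of i j] ij k by auto
    then have lij: "l \<noteq> i" "l \<noteq> j" using sym[of k l] l by auto
    obtain m where "m \<notin> set [i, j, k, l]" using obtain_fresh[OF card, of "[i, j, k, l]"] by auto
    then have m: "distinct [i, j, k, l, m]" using ij k l lij by auto
    obtain n where n: "n \<noteq> m" "R m n" using ex by blast
    then consider "n = i" | "n = j" | "n = k" | "n = l"
      using five_distinct_UNIV[OF card m] by blast
    then show False
    proof cases
      case 1 then show False using matching[of i j m] sym[of m i] ij m n by auto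
    next
      case 2 then show False using matching[of j i m] sym[of m j] sym[of i j] ij m n by auto
    next
      case 3 then show False using matching[of k l m] sym[of m k] l m n by auto
    next
      case 4 then show False using matching[of l k m] sym[of m l] sym[of k l] l m n by auto
    qed
  qed
  then show thesis using that by blast
qed

section \<open>Projective frames\<close>

text \<open>
  Up to scalars, the sum is the only linear relation of the family. For \<open>n + 1\<close> vectors in an
  \<open>n\<close>-dimensional space this is a projective frame in the usual sense, normalised to sum \<open>0\<close>; no
  member of the family is distinguished, so permuting the indices is free.
\<close>

definition projective_frame :: "('i::finite \<Rightarrow> 'a::field ^ 'n) \<Rightarrow> bool" where
  "projective_frame p \<longleftrightarrow>
     (\<Sum>i\<in>UNIV. p i) = 0 \<and> (\<forall>c. (\<Sum>i\<in>UNIV. c i *s p i) = 0 \<longrightarrow> (\<forall>i j. c i = c j))"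

text \<open>The entry at \<open>None\<close> is the vector with all coordinates \<open>-1\<close>.\<close>

definition standard_frame :: "'n option \<Rightarrow> 'a::field ^ 'n" where
  "standard_frame i = (case i of Some t \<Rightarrow> axis t 1 | None \<Rightarrow> - 1)"

lemma projective_frame_standard: "projective_frame (standard_frame :: _ \<Rightarrow> 'a::field ^ 'n)"
proof -
  have comb: "(\<Sum>i\<in>UNIV. c i *s (standard_frame i :: 'a ^ 'n)) $ t = c (Some t) - c None" for c t
  proof -
    have "(\<Sum>i\<in>UNIV. c i *s (standard_frame i :: 'a ^ 'n)) $ t
        = - c None + (\<Sum>x\<in>UNIV. c (Some x) * axis x 1 $ t)"
      by (simp add: UNIV_option_conv sum.reindex standard_frame_def)
    also have "(\<Sum>x\<in>UNIV. c (Some x) * axis x 1 $ t) = c (Some t)"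
      by (simp add: axis_def if_distrib cong: if_cong)
    finally show ?thesis by simp
  qed
  have "(\<Sum>i\<in>UNIV. (standard_frame i :: 'a ^ 'n)) = 0"
    using comb[of "\<lambda>_. 1"] by (simp add: vec_eq_iff)
  moreover have "c i = c j"
    if "(\<Sum>i\<in>UNIV. c i *s (standard_frame i :: 'a ^ 'n)) = 0" for c i j
  proof -
    have "c x = c None" for x
      using comb[of c] that by (cases x) auto
    then show ?thesis by metis
  qed
  ultimately show ?thesis unfolding projective_frame_def by blast
qed

lemma frame_relation:
  assumes "CARD('i::finite) = 5" and "projective_frame (p :: 'i::finite \<Rightarrow> _)"
    and "distinct [i, j, k, l, m]"
    and "a *s p i + b *s p j + c *s p k + d *s p l + e *s p m = 0"
  shows "a = b \<and> b = c \<and> c = d \<and> d = e"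
proof -
  define g where "g x = (if x = i then a else if x = j then b else if x = k then c
    else if x = l then d else e)" for x
  have g: "g i = a" "g j = b" "g k = c" "g l = d" "g m = e" using assms(3) by (auto simp: g_def)
  have "(\<Sum>x\<in>UNIV. g x *s p x) = 0"
    unfolding five_distinct_UNIV[OF assms(1,3)] using assms(3,4) g by (simp add: add.assoc)
  then show ?thesis using assms(2) g unfolding projective_frame_def by metis
qed

lemma frame_sum:
  assumes "CARD('i::finite) = 5" and "projective_frame (p :: 'i::finite \<Rightarrow> _)"
    and "distinct [i, j, k, l, m]"
  shows "p i + p j + p k + p l + p m = 0"
proof -
  have "(\<Sum>x\<in>UNIV. p x) = 0" using assms(2) unfolding projective_frame_def by blast
  then show ?thesis
    unfolding five_distinct_UNIV[OF assms(1,3)] using assms(3) by (simp add: add.assoc)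
qed

lemma frame_independent4:
  assumes card: "CARD('i::finite) = 5" and frame: "projective_frame (p :: 'i::finite \<Rightarrow> _)"
    and dist: "distinct [i, j, k, l]"
  shows "independent4 (p i) (p j) (p k) (p l)"
  unfolding independent4_def
proof (intro allI impI)
  obtain m where "m \<notin> set [i, j, k, l]" using obtain_fresh[OF card, of "[i, j, k, l]"] by auto
  then have dist': "distinct [i, j, k, l, m]" using dist by auto
  fix a b c d assume "a *s p i + b *s p j + c *s p k + d *s p l = 0"
  then have "a *s p i + b *s p j + c *s p k + d *s p l + 0 *s p m = 0" by simp
  from frame_relation[OF card frame dist' this] show "a = 0 \<and> b = 0 \<and> c = 0 \<and> d = 0" by auto
qed

text \<open>
  Five vectors in dimension four satisfy a nontrivial relation. General position forces every
  coefficient to be nonzero, and absorbing the coefficients into the vectors turns the relation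
  into the sum.
\<close>

lemma rescale_to_frame:
  fixes w :: "'i::finite \<Rightarrow> 'a::field ^ 4"
  assumes card: "CARD('i) = 5"
    and ind: "\<And>i j k l. distinct [i, j, k, l] \<Longrightarrow> independent4 (w i) (w j) (w k) (w l)"
  obtains p where "projective_frame p" "\<And>i. proportional (w i) (p i)"
proof -
  obtain i :: 'i where "i \<notin> set []" using obtain_fresh[OF card, of "[]"] by auto
  obtain j where "j \<notin> set [i]" using obtain_fresh[OF card, of "[i]"] by auto
  then obtain k l m where dist: "distinct [i, j, k, l, m]"
    using extend_to_five[OF card, of i j] by auto
  have univ: "UNIV = {i, j, k, l, m}" by (rule five_distinct_UNIV[OF card dist])
  have "independent4 (w i) (w j) (w k) (w l)" using ind dist by simp
  then obtain a b c d where eq: "w m = a *s w i + b *s w j + c *s w k + d *s w l"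
    using independent4_spans by blast
  have nz: "a \<noteq> 0" "b \<noteq> 0" "c \<noteq> 0" "d \<noteq> 0"
  proof -
    have i4: "independent4 (w m) (w j) (w k) (w l)" "independent4 (w i) (w m) (w k) (w l)"
      "independent4 (w i) (w j) (w m) (w l)" "independent4 (w i) (w j) (w k) (w m)"
      using dist by (auto intro!: ind)
    show "a \<noteq> 0"
      using i4(1)[unfolded independent4_def, rule_format, of "-1" b c d] eq by auto
    show "b \<noteq> 0"
      using i4(2)[unfolded independent4_def, rule_format, of a "-1" c d] eq by auto
    show "c \<noteq> 0"
      using i4(3)[unfolded independent4_def, rule_format, of a b "-1" d] eq by auto
    show "d \<noteq> 0"
      using i4(4)[unfolded independent4_def, rule_format, of a b c "-1"] eq by auto
  qed
  define s where "s x = (if x = i then a else if x = j then b else if x = k then c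
    else if x = l then d else -1)" for x
  have s: "s i = a" "s j = b" "s k = c" "s l = d" "s m = -1" using dist by (auto simp: s_def)
  have snz: "s x \<noteq> 0" for x using nz by (simp add: s_def)
  have "(\<Sum>x\<in>UNIV. s x *s w x) = 0"
    unfolding univ using dist s eq by (simp add: algebra_simps)
  \<comment> \<open>Subtracting \<open>g m\<close> times the basic relation leaves a relation of only four vectors.\<close>
  moreover have "g x = g m" if "(\<Sum>x\<in>UNIV. g x *s (s x *s w x)) = 0" for g x
  proof -
    have "g i *s (a *s w i) + g j *s (b *s w j) + g k *s (c *s w k) + g l *s (d *s w l)
        - g m *s w m = 0"
      using that unfolding univ using dist s by (simp add: algebra_simps)
    then have "((g i - g m) * a) *s w i + ((g j - g m) * b) *s w j
        + ((g k - g m) * c) *s w k + ((g l - g m) * d) *s w l = 0"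
      unfolding eq by (simp add: vector_add_ldistrib vector_ssub_ldistrib vector_sadd_rdistrib
          vector_smult_assoc left_diff_distrib vec.scale_left_diff_distrib algebra_simps)
    then have "(g i - g m) * a = 0 \<and> (g j - g m) * b = 0 \<and> (g k - g m) * c = 0 \<and> (g l - g m) * d = 0"
      using \<open>independent4 (w i) (w j) (w k) (w l)\<close> unfolding independent4_def by blast
    then have "g i = g m \<and> g j = g m \<and> g k = g m \<and> g l = g m" using nz by simp
    then show ?thesis using univ by auto
  qed
  then have "g x = g y" if "(\<Sum>x\<in>UNIV. g x *s (s x *s w x)) = 0" for g x y
    using that by metis
  ultimately have "projective_frame (\<lambda>x. s x *s w x)"
    unfolding projective_frame_def by blast
  moreover have "proportional (w x) (s x *s w x)" for x
    unfolding proportional_def using snz[of x] by (intro exI[of _ "inverse (s x)"]) simp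
  ultimately show thesis by (rule that)
qed

section \<open>The possible images of an edge\<close>

locale frame_preserving_map =
  fixes f :: "2 mod_ring ^ 4 \<Rightarrow> 3 mod_ring ^ 4"
    and u :: "'i::finite \<Rightarrow> 2 mod_ring ^ 4" and p :: "'i \<Rightarrow> 3 mod_ring ^ 4"
  assumes card_index: "CARD('i) = 5"
    and independent_image: "independent4 x y z w \<Longrightarrow> independent4 (f x) (f y) (f z) (f w)"
    and frame_u: "projective_frame u" and frame_p: "projective_frame p"
    and vertex: "proportional (f (u i)) (p i)"
begin

definition sum_edge :: "'i \<Rightarrow> 'i \<Rightarrow> bool" where
  "sum_edge i j \<longleftrightarrow> proportional (f (u i + u j)) (p i + p j)"

definition diff_edge :: "'i \<Rightarrow> 'i \<Rightarrow> bool" where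
  "diff_edge i j \<longleftrightarrow> proportional (f (u i + u j)) (p i - p j)"

definition defect_edge :: "'i \<Rightarrow> 'i \<Rightarrow> 'i \<Rightarrow> bool" where
  "defect_edge i j x \<longleftrightarrow> proportional (f (u i + u j)) (p i + p j - p x)"

lemma sum_edge_sym: "sum_edge i j \<Longrightarrow> sum_edge j i"
  by (simp add: sum_edge_def add.commute)

lemma diff_edge_sym: "diff_edge i j \<Longrightarrow> diff_edge j i"
proof -
  assume "diff_edge i j"
  then obtain c where "c \<noteq> 0" "f (u j + u i) = c *s (p i - p j)"
    unfolding diff_edge_def proportional_def by (auto simp: add.commute)
  then have "- c \<noteq> 0" "f (u j + u i) = (- c) *s (p j - p i)"
    by (auto simp: vec.scale_right_diff_distrib)
  then show ?thesis unfolding diff_edge_def proportional_def by blast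
qed

lemma defect_edge_sym: "defect_edge i j x \<Longrightarrow> defect_edge j i x"
  by (simp add: defect_edge_def add.commute)

lemmas relation_u = frame_relation[OF card_index frame_u]
lemmas sum_p = frame_sum[OF card_index frame_p]
lemmas image_independent4 = independent4_proportional[OF independent_image]

lemma source_edge:
  assumes "distinct [i, j, k, l, m]"
  shows "independent4 (u i + u j) (u i) (u k) (u l)"
  unfolding independent4_def
proof (intro allI impI)
  fix a b c d assume "a *s (u i + u j) + b *s u i + c *s u k + d *s u l = 0"
  then have "(a + b) *s u i + a *s u j + c *s u k + d *s u l + 0 *s u m = 0"
    by (simp add: vector_add_ldistrib vector_sadd_rdistrib algebra_simps)
  from relation_u[OF assms this] show "a = 0 \<and> b = 0 \<and> c = 0 \<and> d = 0" by auto
qed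

text \<open>
  Modulo \<open>p\<^sub>i\<close>, \<open>p\<^sub>k\<close>, \<open>p\<^sub>l\<close> the vector \<open>p\<^sub>m\<close> is \<open>- p\<^sub>j\<close>, so the image of the edge becomes
  \<open>(b - e) p\<^sub>j\<close>, which must not vanish because \<open>u\<^sub>i + u\<^sub>j\<close>, \<open>u\<^sub>i\<close>, \<open>u\<^sub>k\<close>, \<open>u\<^sub>l\<close> are independent.
\<close>

lemma edge_coefficient_neq:
  assumes dist: "distinct [i, j, k, l, m]"
    and eq: "f (u i + u j) = a *s p i + b *s p j + c *s p k + d *s p l + e *s p m"
  shows "b \<noteq> e"
proof
  assume "b = e"
  have "f (u i + u j) + (b - a) *s p i + (b - c) *s p k + (b - d) *s p l
      = b *s (p i + p j + p k + p l + p m)"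
    unfolding eq \<open>b = e\<close>
    by (simp add: vector_add_ldistrib vector_sadd_rdistrib vec.scale_left_diff_distrib algebra_simps)
  also have "\<dots> = 0" by (simp only: sum_p[OF dist] vector_smult_rzero)
  finally have zero: "f (u i + u j) + (b - a) *s p i + (b - c) *s p k + (b - d) *s p l = 0" .
  have "proportional x x" for x :: "3 mod_ring ^ 4"
    unfolding proportional_def by (intro exI[of _ 1]) simp
  then have "independent4 (f (u i + u j)) (p i) (p k) (p l)"
    using image_independent4[OF source_edge[OF dist]] vertex by blast
  then show False using independent4D zero by blast
qed

text \<open>
  In frame coordinates, which matter only up to a common shift, the coefficients at \<open>i\<close> and at \<open>j\<close>
  must differ from the three others. If they differ from each other, then all the others have the
  third value, and shifting it to \<open>0\<close> gives a difference edge. If they agree, the other three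
  coefficients take the two remaining values. Shift the more frequent one to \<open>0\<close>: at most one
  nonzero coefficient is left outside \<open>i\<close> and \<open>j\<close>, and it is the negative of the common one.
\<close>

lemma edge_cases:
  assumes "i \<noteq> j"
  obtains "sum_edge i j" | "diff_edge i j" | x where "x \<noteq> i" "x \<noteq> j" "defect_edge i j x"
proof -
  obtain k l m where dist: "distinct [i, j, k, l, m]"
    using extend_to_five[OF card_index assms] by blast
  have "independent4 (p i) (p j) (p k) (p l)"
    using frame_independent4[OF card_index frame_p] dist by simp
  then obtain a b c d where eq: "f (u i + u j) = a *s p i + b *s p j + c *s p k + d *s p l"
    using independent4_spans by blast
  \<comment> \<open>The coefficient at \<open>m\<close> is \<open>0\<close>; exchanging \<open>m\<close> with \<open>l\<close> or \<open>k\<close>, and \<open>i\<close> with \<open>j\<close>, gives all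
    six inequalities.\<close>
  have "b \<noteq> 0" using edge_coefficient_neq[of i j k l m a b c d 0] dist eq by simp
  moreover have "b \<noteq> c" using edge_coefficient_neq[of i j l m k a b d 0 c]
    dist eq by (auto simp: algebra_simps)
  moreover have "b \<noteq> d" using edge_coefficient_neq[of i j k m l a b c 0 d]
    dist eq by (auto simp: algebra_simps)
  moreover have a: "a \<noteq> 0" using edge_coefficient_neq[of j i k l m b a c d 0]
    dist eq by (auto simp: algebra_simps)
  moreover have "a \<noteq> c" using edge_coefficient_neq[of j i l m k b a d 0 c]
    dist eq by (auto simp: algebra_simps)
  moreover have "a \<noteq> d" using edge_coefficient_neq[of j i k m l b a c 0 d]
    dist eq by (auto simp: algebra_simps)
  ultimately consider "b = - a" "c = 0" "d = 0" | "b = a" "c = 0" "d = 0" | "b = a" "c = - a" "d = 0"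
    | "b = a" "c = 0" "d = - a" | "b = a" "c = - a" "d = - a"
    using mod_ring_3_eq_multiple[OF a, of b] mod_ring_3_eq_multiple[OF a, of c]
      mod_ring_3_eq_multiple[OF a, of d] by blast
  then show thesis
  proof cases
    case 1
    then have "f (u i + u j) = a *s (p i - p j)"
      using eq by (simp add: vec.scale_right_diff_distrib)
    then show thesis using that(2) a unfolding diff_edge_def proportional_def by blast
  next
    case 2
    then have "f (u i + u j) = a *s (p i + p j)"
      using eq by (simp add: vector_add_ldistrib)
    then show thesis using that(1) a unfolding sum_edge_def proportional_def by blast
  next
    case 3
    then have "f (u i + u j) = a *s (p i + p j - p k)"
      using eq by (simp add: vector_add_ldistrib vec.scale_right_diff_distrib)
    then show thesis using that(3)[of k] a dist unfolding defect_edge_def proportional_def by auto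
  next
    case 4
    then have "f (u i + u j) = a *s (p i + p j - p l)"
      using eq by (simp add: vector_add_ldistrib vec.scale_right_diff_distrib)
    then show thesis using that(3)[of l] a dist unfolding defect_edge_def proportional_def by auto
  next
    \<comment> \<open>Here the value \<open>- a\<close> is the more frequent one outside \<open>i\<close> and \<open>j\<close>, and the odd coefficient
      is the \<open>0\<close> at \<open>m\<close>.\<close>
    case 5
    then have "f (u i + u j) = a *s (p i + p j - p k - p l)"
      using eq by (simp add: vector_add_ldistrib vec.scale_right_diff_distrib)
    also have "p i + p j - p k - p l = (p i + p i + p i) + (p j + p j + p j)
        - (p i + p j + p k + p l + p m) - (p i + p j - p m)" by simp
    also have "\<dots> = - (p i + p j - p m)" by (simp only: triple_eq_zero sum_p[OF dist]) simp
    finally have "f (u i + u j) = (- a) *s (p i + p j - p m)"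
      by (simp only: vec.scale_minus_left vec.scale_minus_right)
    then show thesis using that(3)[of m] a dist unfolding defect_edge_def proportional_def
      by (metis distinct_length_2_or_more neg_equal_0_iff_equal)
  qed
qed

section \<open>Independent configurations of edges over the field with two elements\<close>

text \<open>
  Each configuration is expanded in frame coordinates, where independence means that the five
  coefficients can only be equal if all scalars vanish.
\<close>

lemma source_path_outside:
  assumes "distinct [i, j, k, l, m]"
  shows "independent4 (u i + u j) (u i + u k) (u l) (u m)"
  unfolding independent4_def
proof (intro allI impI)
  fix a b c d assume "a *s (u i + u j) + b *s (u i + u k) + c *s u l + d *s u m = 0"
  then have "(a + b) *s u i + a *s u j + b *s u k + c *s u l + d *s u m = 0"
    by (simp add: vector_add_ldistrib vector_sadd_rdistrib algebra_simps)
  from relation_u[OF assms this] show "a = 0 \<and> b = 0 \<and> c = 0 \<and> d = 0" by auto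
qed

lemma source_path_end:
  assumes "distinct [i, j, k, l, m]"
  shows "independent4 (u i + u j) (u i + u k) (u j) (u l)"
  unfolding independent4_def
proof (intro allI impI)
  fix a b c d assume "a *s (u i + u j) + b *s (u i + u k) + c *s u j + d *s u l = 0"
  then have "(a + b) *s u i + (a + c) *s u j + b *s u k + d *s u l + 0 *s u m = 0"
    by (simp add: vector_add_ldistrib vector_sadd_rdistrib algebra_simps)
  from relation_u[OF assms this] show "a = 0 \<and> b = 0 \<and> c = 0 \<and> d = 0" by auto
qed

lemma source_path_centre:
  assumes "distinct [i, j, k, l, m]"
  shows "independent4 (u i + u j) (u i + u k) (u i) (u l)"
  unfolding independent4_def
proof (intro allI impI)
  fix a b c d assume "a *s (u i + u j) + b *s (u i + u k) + c *s u i + d *s u l = 0"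
  then have "(a + b + c) *s u i + a *s u j + b *s u k + d *s u l + 0 *s u m = 0"
    by (simp add: vector_add_ldistrib vector_sadd_rdistrib algebra_simps)
  from relation_u[OF assms this] show "a = 0 \<and> b = 0 \<and> c = 0 \<and> d = 0" by auto
qed

lemma source_disjoint:
  assumes "distinct [i, j, k, l, m]"
  shows "independent4 (u i + u j) (u k + u l) (u i) (u k)"
  unfolding independent4_def
proof (intro allI impI)
  fix a b c d assume "a *s (u i + u j) + b *s (u k + u l) + c *s u i + d *s u k = 0"
  then have "(a + c) *s u i + a *s u j + (b + d) *s u k + b *s u l + 0 *s u m = 0"
    by (simp add: vector_add_ldistrib vector_sadd_rdistrib algebra_simps)
  from relation_u[OF assms this] show "a = 0 \<and> b = 0 \<and> c = 0 \<and> d = 0" by auto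
qed

text \<open>
  The only configuration that needs characteristic two: equal coefficients force \<open>4 a = a\<close>, and
  \<open>3 a = 0\<close> implies \<open>a = 0\<close> exactly because \<open>3\<close> is invertible.
\<close>

lemma source_star:
  assumes "distinct [i, j, k, l, m]"
  shows "independent4 (u i + u j) (u i + u k) (u i + u l) (u i + u m)"
  unfolding independent4_def
proof (intro allI impI)
  fix a b c d
  assume "a *s (u i + u j) + b *s (u i + u k) + c *s (u i + u l) + d *s (u i + u m) = 0"
  then have "(a + b + c + d) *s u i + a *s u j + b *s u k + c *s u l + d *s u m = 0"
    by (simp add: vector_add_ldistrib vector_sadd_rdistrib algebra_simps)
  from relation_u[OF assms this] have r: "a + b + c + d = a" "a = b" "b = c" "c = d"
    by blast+
  then have eqs: "b = a" "c = a" "d = a" by blast+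
  have "(a + a) + (a + a) = a" using r(1) unfolding eqs by (simp only: add.assoc)
  moreover have "a + a = 0" using mod_ring_2_cases[of a] mod_ring_2_two by auto
  ultimately have "a = 0" by (simp only: add_0_left)
  then show "a = 0 \<and> b = 0 \<and> c = 0 \<and> d = 0" using eqs by simp
qed

lemma source_triple:
  assumes "distinct [i, j, k, l, m]"
  shows "independent4 (u i + u j) (u i + u k) (u j + u m) (u i)"
  unfolding independent4_def
proof (intro allI impI)
  fix a b c d
  assume "a *s (u i + u j) + b *s (u i + u k) + c *s (u j + u m) + d *s u i = 0"
  then have "(a + b + d) *s u i + (a + c) *s u j + b *s u k + 0 *s u l + c *s u m = 0"
    by (simp add: vector_add_ldistrib vector_sadd_rdistrib algebra_simps)
  from relation_u[OF assms this] show "a = 0 \<and> b = 0 \<and> c = 0 \<and> d = 0" by auto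
qed

section \<open>Edges that are not sum edges form a matching\<close>

text \<open>
  The images satisfy \<open>(p\<^sub>i - p\<^sub>j) + (p\<^sub>i - p\<^sub>k) = p\<^sub>l + p\<^sub>m\<close>. In this and the following relations, the
  difference of the two sides is a combination of multiples of \<open>3\<close> and of the sum of the frame.
\<close>

lemma no_adjacent_diff_edges:
  assumes dist: "distinct [i, j, k, l, m]" and "diff_edge i j" "diff_edge i k"
  shows False
proof -
  have "independent4 (p i - p j) (p i - p k) (p l) (p m)"
    using image_independent4[OF source_path_outside[OF dist]] vertex assms(2,3)
    unfolding diff_edge_def by blast
  moreover have "(p i - p j) + 1 *s (p i - p k) + (- 1) *s p l + (- 1) *s p m
      = (p i + p i + p i) - (p i + p j + p k + p l + p m)" by simp
  ultimately show False using independent4D by (metis sum_p[OF dist] triple_eq_zero diff_zero)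
qed

text \<open>
  A defect edge and a difference edge cannot share a point. The point deleted by the defect edge
  is either the other end of the difference edge or off both edges.
\<close>

lemma no_defect_diff_edges_end:
  assumes dist: "distinct [i, j, k, l, m]" and "defect_edge i j k" "diff_edge i k"
  shows False
proof -
  have "independent4 (p i + p j - p k) (p i - p k) (p j) (p l)"
    using image_independent4[OF source_path_end[OF dist]] vertex assms(2-)
    unfolding diff_edge_def defect_edge_def by blast
  moreover have "(p i + p j - p k) + (- 1) *s (p i - p k) + (- 1) *s (p j) + 0 *s (p l)
      = 0" by simp
  ultimately show False using independent4D
    by (metis sum_p[OF dist] triple_eq_zero add_0 diff_zero)
qed

lemma no_defect_diff_edges_outside:
  assumes dist: "distinct [i, j, k, l, m]" and "defect_edge i j m" "diff_edge i k"
  shows False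
proof -
  have "independent4 (p i + p j - p m) (p i - p k) (p j) (p l)"
    using image_independent4[OF source_path_end[OF dist]] vertex assms(2-)
    unfolding diff_edge_def defect_edge_def by blast
  moreover have "(p i + p j - p m) + 1 *s (p i - p k) + 1 *s (p j) + (- 1) *s (p l)
      = (p i + p i + p i) + (p j + p j + p j) - (p i + p j + p k + p l + p m)" by simp
  ultimately show False using independent4D
    by (metis sum_p[OF dist] triple_eq_zero add_0 diff_zero)
qed

text \<open>
  For two defect edges \<open>ij\<close> and \<open>ik\<close>, the three lemmas below exclude that one of them deletes an end
  of the other and that both delete the same point.
\<close>

lemma no_adjacent_defects_both_ends:
  assumes dist: "distinct [i, j, k, l, m]" and "defect_edge i j k" "defect_edge i k j"
  shows False
proof -
  have "independent4 (p i + p j - p k) (p i + p k - p j) (p i) (p l)"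
    using image_independent4[OF source_path_centre[OF dist]] vertex assms(2-)
    unfolding defect_edge_def by blast
  moreover have "(p i + p j - p k) + 1 *s (p i + p k - p j) + 1 *s (p i) + 0 *s (p l)
      = (p i + p i + p i)" by simp
  ultimately show False using independent4D
    by (metis sum_p[OF dist] triple_eq_zero add_0 diff_zero)
qed

lemma no_adjacent_defects_one_end:
  assumes dist: "distinct [i, j, k, l, m]" and "defect_edge i j k" "defect_edge i k m"
  shows False
proof -
  have "independent4 (p i + p j - p k) (p i + p k - p m) (p i) (p l)"
    using image_independent4[OF source_path_centre[OF dist]] vertex assms(2-)
    unfolding defect_edge_def by blast
  moreover have "(p i + p j - p k) + (- 1) *s (p i + p k - p m) + 1 *s (p i) + 1 *s (p l)
      = (p i + p j + p k + p l + p m) - (p k + p k + p k)" by simp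
  ultimately show False using independent4D
    by (metis sum_p[OF dist] triple_eq_zero add_0 diff_zero)
qed

lemma no_adjacent_defects_same:
  assumes dist: "distinct [i, j, k, l, m]" and "defect_edge i j m" "defect_edge i k m"
  shows False
proof -
  have "independent4 (p i + p j - p m) (p i + p k - p m) (p i) (p l)"
    using image_independent4[OF source_path_centre[OF dist]] vertex assms(2-)
    unfolding defect_edge_def by blast
  moreover have "(p i + p j - p m) + 1 *s (p i + p k - p m) + (- 1) *s (p i) + 1 *s (p l)
      = (p i + p j + p k + p l + p m) - (p m + p m + p m)" by simp
  ultimately show False using independent4D
    by (metis sum_p[OF dist] triple_eq_zero add_0 diff_zero)
qed

text \<open>
  Defect edges cannot be disjoint either. The three lemmas below distinguish whether the deleted
  points are ends of the other edge; in the last one the two images even add up to \<open>0\<close>.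
\<close>

lemma no_disjoint_defects_crossing:
  assumes dist: "distinct [i, j, k, l, m]" and "defect_edge i j l" "defect_edge k l j"
  shows False
proof -
  have "independent4 (p i + p j - p l) (p k + p l - p j) (p i) (p k)"
    using image_independent4[OF source_disjoint[OF dist]] vertex assms(2-)
    unfolding defect_edge_def by blast
  moreover have "(p i + p j - p l) + 1 *s (p k + p l - p j) + (- 1) *s (p i) + (- 1) *s (p k)
      = 0" by simp
  ultimately show False using independent4D
    by (metis sum_p[OF dist] triple_eq_zero add_0 diff_zero)
qed

lemma no_disjoint_defects_one_outside:
  assumes dist: "distinct [i, j, k, l, m]" and "defect_edge i j l" "defect_edge k l m"
  shows False
proof -
  have "independent4 (p i + p j - p l) (p k + p l - p m) (p i) (p k)"
    using image_independent4[OF source_disjoint[OF dist]] vertex assms(2-)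
    unfolding defect_edge_def by blast
  moreover have "(p i + p j - p l) + (- 1) *s (p k + p l - p m) + 0 *s (p i) + (- 1) *s (p k)
      = (p i + p j + p k + p l + p m) - (p k + p k + p k) - (p l + p l + p l)" by simp
  ultimately show False using independent4D
    by (metis sum_p[OF dist] triple_eq_zero add_0 diff_zero)
qed

lemma no_disjoint_defects_same:
  assumes dist: "distinct [i, j, k, l, m]" and "defect_edge i j m" "defect_edge k l m"
  shows False
proof -
  have "independent4 (p i + p j - p m) (p k + p l - p m) (p i) (p k)"
    using image_independent4[OF source_disjoint[OF dist]] vertex assms(2-)
    unfolding defect_edge_def by blast
  moreover have "(p i + p j - p m) + 1 *s (p k + p l - p m) + 0 *s (p i) + 0 *s (p k)
      = (p i + p j + p k + p l + p m) - (p m + p m + p m)" by simp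
  ultimately show False using independent4D
    by (metis sum_p[OF dist] triple_eq_zero add_0 diff_zero)
qed

text \<open>
  Adjacent defect edges that delete different points off both of them survive every test on these
  two edges alone. They are excluded through a third edge, from \<open>j\<close> to the point deleted by \<open>ik\<close>.
\<close>

lemma no_sum_edge_closing_defects:
  assumes dist: "distinct [i, j, k, l, m]" and "defect_edge i j l" "defect_edge i k m" "sum_edge j m"
  shows False
proof -
  have "independent4 (p i + p j - p l) (p i + p k - p m) (p j + p m) (p i)"
    using image_independent4[OF source_triple[OF dist]] vertex assms(2-)
    unfolding sum_edge_def defect_edge_def by blast
  moreover have "(p i + p j - p l) + (- 1) *s (p i + p k - p m) + 1 *s (p j + p m) + (- 1) *s (p i)
      = (p j + p j + p j) + (p m + p m + p m) - (p i + p j + p k + p l + p m)" by simp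
  ultimately show False using independent4D
    by (metis sum_p[OF dist] triple_eq_zero add_0 diff_zero)
qed

text \<open>
  The image vectors add up to \<open>3 p\<^sub>i\<close> plus the sum of the frame, hence to \<open>0\<close>.
\<close>

lemma no_star_of_sum_edges:
  assumes dist: "distinct [i, j, k, l, m]" and "sum_edge i j" "sum_edge i k" "sum_edge i l" "sum_edge i m"
  shows False
proof -
  have "independent4 (p i + p j) (p i + p k) (p i + p l) (p i + p m)"
    using image_independent4[OF source_star[OF dist]] vertex assms(2-)
    unfolding sum_edge_def by blast
  moreover have "(p i + p j) + 1 *s (p i + p k) + 1 *s (p i + p l) + 1 *s (p i + p m)
      = (p i + p i + p i) + (p i + p j + p k + p l + p m)" by simp
  ultimately show False using independent4D
    by (metis sum_p[OF dist] triple_eq_zero add_0 diff_zero)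
qed

lemma no_adjacent_defect_diff_edges:
  assumes ijk: "distinct [i, j, k]" and "defect_edge i j x" "x \<noteq> i" "x \<noteq> j" and "diff_edge i k"
  shows False
proof (cases "x = k")
  case True
  obtain l where "l \<notin> set [i, j, k]" using obtain_fresh[OF card_index, of "[i, j, k]"] by auto
  moreover obtain m where "m \<notin> set [i, j, k, l]"
    using obtain_fresh[OF card_index, of "[i, j, k, l]"] by auto
  ultimately show False using no_defect_diff_edges_end[of i j k l m] assms True by auto
next
  case False
  obtain l where "l \<notin> set [i, j, k, x]" using obtain_fresh[OF card_index, of "[i, j, k, x]"] by auto
  then show False using no_defect_diff_edges_outside[of i j k l x] assms False by auto
qed

lemma no_disjoint_defect_edges:
  assumes ijkl: "distinct [i, j, k, l]"
    and dij: "defect_edge i j x" "x \<noteq> i" "x \<noteq> j" and dkl: "defect_edge k l y" "y \<noteq> k" "y \<noteq> l"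
  shows False
proof -
  obtain m where "m \<notin> set [i, j, k, l]"
    using obtain_fresh[OF card_index, of "[i, j, k, l]"] by auto
  then have dist: "distinct [i, j, k, l, m]" using ijkl by auto
  have "x \<in> {k, l, m}" "y \<in> {i, j, m}"
    using five_distinct_UNIV[OF card_index dist] dij dkl by auto
  \<comment> \<open>It remains to match each pair of deleted points with one of the three patterns, up to
    reversing either edge or exchanging the two.\<close>
  then consider "x = k" "y = i" | "x = k" "y = j" | "x = l" "y = i" | "x = l" "y = j"
    | "x = k" "y = m" | "x = l" "y = m" | "x = m" "y = i" | "x = m" "y = j" | "x = m" "y = m"
    by blast
  then show False
  proof cases
    case 1 then show False
      using no_disjoint_defects_crossing[of j i l k m] dist dij dkl defect_edge_sym by auto
  next
    case 2 then show False
      using no_disjoint_defects_crossing[of i j l k m] dist dij dkl defect_edge_sym by auto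
  next
    case 3 then show False
      using no_disjoint_defects_crossing[of j i k l m] dist dij dkl defect_edge_sym by auto
  next
    case 4 then show False
      using no_disjoint_defects_crossing[of i j k l m] dist dij dkl defect_edge_sym by auto
  next
    case 5 then show False
      using no_disjoint_defects_one_outside[of i j l k m] dist dij dkl defect_edge_sym by auto
  next
    case 6 then show False
      using no_disjoint_defects_one_outside[of i j k l m] dist dij dkl by auto
  next
    case 7 then show False
      using no_disjoint_defects_one_outside[of k l j i m] dist dij dkl defect_edge_sym by auto
  next
    case 8 then show False
      using no_disjoint_defects_one_outside[of k l i j m] dist dij dkl by auto
  next
    case 9 then show False
      using no_disjoint_defects_same[of i j k l m] dist dij dkl by auto
  qed
qed

text \<open>
  The edge \<open>jm\<close> has no possible image. It is not a sum edge, not a difference edge because it meets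
  the defect edge \<open>ij\<close>, and not a defect edge because it is disjoint from the defect edge \<open>ik\<close>.
\<close>

lemma no_adjacent_defects_outside:
  assumes dist: "distinct [i, j, k, l, m]" and dij: "defect_edge i j l" and dik: "defect_edge i k m"
  shows False
proof -
  have "j \<noteq> m" using dist by simp
  then show False
  proof (cases rule: edge_cases)
    case 1
    then show False using no_sum_edge_closing_defects[OF dist dij dik] by blast
  next
    case 2
    then show False
      using no_adjacent_defect_diff_edges[of j i m l] defect_edge_sym[OF dij] dist by auto
  next
    case (3 x)
    then show False using no_disjoint_defect_edges[of i k j m m x] dik dist by auto
  qed
qed

lemma no_adjacent_defect_edges:
  assumes ijk: "distinct [i, j, k]"
    and dij: "defect_edge i j x" "x \<noteq> i" "x \<noteq> j" and dik: "defect_edge i k y" "y \<noteq> i" "y \<noteq> k"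
  shows False
proof -
  obtain l where l: "l \<notin> set [i, j, k]" using obtain_fresh[OF card_index, of "[i, j, k]"] by auto
  obtain m where m: "m \<notin> set [i, j, k, l]"
    using obtain_fresh[OF card_index, of "[i, j, k, l]"] by auto
  have dist: "distinct [i, j, k, l, m]" using ijk l m by auto
  have "x \<in> {k, l, m}" "y \<in> {j, l, m}"
    using five_distinct_UNIV[OF card_index dist] dij dik by auto
  then consider "x = k" "y = j" | "x = k" "y = l" | "x = k" "y = m" | "x = l" "y = j"
    | "x = m" "y = j" | "x = l" "y = l" | "x = m" "y = m" | "x = l" "y = m" | "x = m" "y = l"
    by blast
  then show False
  proof cases
    case 1 then show False using no_adjacent_defects_both_ends[of i j k l m] dist dij dik by auto
  next
    case 2 then show False using no_adjacent_defects_one_end[of i j k m l] dist dij dik by auto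
  next
    case 3 then show False using no_adjacent_defects_one_end[of i j k l m] dist dij dik by auto
  next
    case 4 then show False using no_adjacent_defects_one_end[of i k j m l] dist dij dik by auto
  next
    case 5 then show False using no_adjacent_defects_one_end[of i k j l m] dist dij dik by auto
  next
    case 6 then show False using no_adjacent_defects_same[of i j k m l] dist dij dik by auto
  next
    case 7 then show False using no_adjacent_defects_same[of i j k l m] dist dij dik by auto
  next
    case 8 then show False using no_adjacent_defects_outside[of i j k l m] dist dij dik by auto
  next
    case 9 then show False using no_adjacent_defects_outside[of i j k m l] dist dij dik by auto
  qed
qed

lemma no_adjacent_nonsum_edges:
  assumes ijk: "distinct [i, j, k]" and "\<not> sum_edge i j" "\<not> sum_edge i k"
  shows False
proof -
  have "i \<noteq> j" "i \<noteq> k" using ijk by auto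
  show False
  proof (cases rule: edge_cases[OF \<open>i \<noteq> j\<close>])
    case 1 then show False using assms by blast
  next
    case dij: 2
    show False
    proof (cases rule: edge_cases[OF \<open>i \<noteq> k\<close>])
      case 1 then show False using assms by blast
    next
      case 2
      obtain l where l: "l \<notin> set [i, j, k]"
        using obtain_fresh[OF card_index, of "[i, j, k]"] by auto
      obtain m where m: "m \<notin> set [i, j, k, l]"
        using obtain_fresh[OF card_index, of "[i, j, k, l]"] by auto
      show False using no_adjacent_diff_edges[of i j k l m] ijk l m dij 2 by auto
    next
      case 3 then show False using no_adjacent_defect_diff_edges[of i k j] ijk dij by auto
    qed
  next
    case dij: (3 x)
    show False
    proof (cases rule: edge_cases[OF \<open>i \<noteq> k\<close>])
      case 1 then show False using assms by blast
    next
      case 2 then show False using no_adjacent_defect_diff_edges[of i j k] ijk dij by auto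
    next
      case (3 y) then show False using no_adjacent_defect_edges[of i j k x y] ijk dij by auto
    qed
  qed
qed

section \<open>The contradiction\<close>

lemma no_frame_preserving_map: False
proof -
  obtain i where star: "\<And>j. j \<noteq> i \<Longrightarrow> sum_edge i j"
    using unmatched_point_of_five[of "\<lambda>i j. \<not> sum_edge i j"] card_index sum_edge_sym
      no_adjacent_nonsum_edges by metis
  obtain j where "j \<notin> set [i]" using obtain_fresh[OF card_index, of "[i]"] by auto
  then obtain k l m where dist: "distinct [i, j, k, l, m]"
    using extend_to_five[OF card_index, of i j] by auto
  then show False using no_star_of_sum_edges[OF dist] star by auto
qed

end

lemma nondegenerate_independent4:
  assumes "nondegenerate_simplicial_map universal_complex universal_complex f"
    and "independent4 x y z w"
  shows "independent4 (f x) (f y) (f z) (f w)"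
proof -
  have xyzw: "distinct [x, y, z, w] \<and> vec.independent {x, y, z, w}"
    using assms(2) by (rule independent4_iff[THEN iffD1])
  then have simplex: "{x, y, z, w} \<in> universal_complex" unfolding universal_complex_def by simp
  have "\<forall>\<sigma>\<in>universal_complex. f ` \<sigma> \<in> universal_complex" "\<forall>\<sigma>\<in>universal_complex. inj_on f \<sigma>"
    using assms(1) unfolding nondegenerate_simplicial_map_def simplicial_map_def by simp_all
  from this[THEN bspec, OF simplex]
  have image: "f ` {x, y, z, w} \<in> universal_complex" and inj: "inj_on f {x, y, z, w}" .
  have "distinct (map f [x, y, z, w])"
    using xyzw inj by (simp only: distinct_map list.set simp_thms)
  then show ?thesis
    using image unfolding independent4_iff universal_complex_def by simp
qed

theorem theorem4p1:
  shows "\<not> (\<exists>f :: 2 mod_ring ^ 4 \<Rightarrow> 3 mod_ring ^ 4.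
           nondegenerate_simplicial_map
             (universal_complex :: (2 mod_ring ^ 4) set set)
             (universal_complex :: (3 mod_ring ^ 4) set set) f)"
proof
  assume "\<exists>f :: 2 mod_ring ^ 4 \<Rightarrow> 3 mod_ring ^ 4.
    nondegenerate_simplicial_map universal_complex universal_complex f"
  then obtain f :: "2 mod_ring ^ 4 \<Rightarrow> 3 mod_ring ^ 4"
    where f: "nondegenerate_simplicial_map universal_complex universal_complex f" ..
  let ?u = "standard_frame :: 4 option \<Rightarrow> 2 mod_ring ^ 4"
  have card: "CARD(4 option) = 5" by (simp add: card_UNIV_option)
  have pres: "independent4 (f x) (f y) (f z) (f w)" if "independent4 x y z w" for x y z w
    using f that by (rule nondegenerate_independent4)
  have "independent4 (f (?u i)) (f (?u j)) (f (?u k)) (f (?u l))" if "distinct [i, j, k, l]"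
    for i j k l
    using that by (intro pres frame_independent4[OF card projective_frame_standard])
  then obtain p where p: "projective_frame p" "\<And>i. proportional (f (?u i)) (p i)"
    by (rule rescale_to_frame[of "\<lambda>i. f (?u i)", OF card]) auto
  have "frame_preserving_map f ?u p"
    by (rule frame_preserving_map.intro[OF card pres projective_frame_standard p])
  then show False by (rule frame_preserving_map.no_frame_preserving_map)
qed

end
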